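(* Let $x_0<0$ and $\alpha>0>\beta$. The domain $\Omega_{\alpha,\beta}$ is $D$-star-shaped with respect to the vector field $D=-3x\partial_x-2y\partial_y$ if and only if $\alpha\ge 1/2$.
   Context: Fix $x_0<0$. Let $A=(2x_0,0)$, $B=(0,0)$, $C=(x_0,y_C)$ with $y_C=-(3|x_0|/2)^{2/3}$, $AC=\{(x,y): y_C\le y\le 0,\ 3(x-2x_0)=2(-y)^{3/2}\}$, $BC=\{(x,y): y_C\le y\le 0,\ 3x=-2(-y)^{3/2}\}$. For $\alpha>0>\beta$ let $g_{\alpha,\beta}(x)=\big[\tfrac{(\alpha+1)|\beta|x(2x_0-x)}{2}\big]^{1/(\alpha+1)}$, $x\in[2x_0,0]$, and $\sigma_{\alpha,\beta}=\{(x,g_{\alpha,\beta}(x)):x\in[2x_0,0]\}$. $\Omega_{\alpha,\beta}$ is the bounded, open, simply connected region with boundary $AC\cup BC\cup\sigma_{\alpha,\beta}$. The flow of $D$ is $\mathcal F_t(\bar x,\bar y)=(\bar xe^{-3t},\bar ye^{-2t})$, $t\in\mathbb R$, and $\mathcal F_{+\infty}(\bar x,\bar y)=\lim_{t\to+\infty}\mathcal F_t(\bar x,\bar y)=(0,0)$. An open set $G\subset\mathbb R^2$ is $D$-star-shaped if for each $(\bar x,\bar y)\in\overline G$ one has $\mathcal F_t(\bar x,\bar y)\in\overline G$ for every $t\in[0,+\infty]$. *)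

theory Defs
  imports "HOL-Analysis.Analysis"
begin

definition pt_A :: "real \<Rightarrow> real \<times> real" where
  "pt_A x0 = (2 * x0, 0)"

definition pt_B :: "real \<times> real" where
  "pt_B = (0, 0)"

definition y_C :: "real \<Rightarrow> real" where
  "y_C x0 = - ((3 * \<bar>x0\<bar> / 2) powr (2 / 3))"

definition pt_C :: "real \<Rightarrow> real \<times> real" where
  "pt_C x0 = (x0, y_C x0)"

definition arc_AC :: "real \<Rightarrow> (real \<times> real) set" where
  "arc_AC x0 = {(x, y). y_C x0 \<le> y \<and> y \<le> 0 \<and> 3 * (x - 2 * x0) = 2 * (- y) powr (3 / 2)}"

definition arc_BC :: "real \<Rightarrow> (real \<times> real) set" where
  "arc_BC x0 = {(x, y). y_C x0 \<le> y \<and> y \<le> 0 \<and> 3 * x = - 2 * (- y) powr (3 / 2)}"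

text \<open>All bases of \<open>powr\<close> here are nonnegative, and \<open>0 powr a = 0\<close> is the
  intended value because every exponent is positive.\<close>

definition g :: "real \<Rightarrow> real \<Rightarrow> real \<Rightarrow> real \<Rightarrow> real" where
  "g x0 \<alpha> \<beta> x = ((\<alpha> + 1) * \<bar>\<beta>\<bar> * x * (2 * x0 - x) / 2) powr (1 / (\<alpha> + 1))"

definition arc_sigma :: "real \<Rightarrow> real \<Rightarrow> real \<Rightarrow> (real \<times> real) set" where
  "arc_sigma x0 \<alpha> \<beta> = {(x, g x0 \<alpha> \<beta> x) | x. x \<in> {2 * x0..0}}"

lemma endpoints_AC: "x0 < 0 \<Longrightarrow> pt_A x0 \<in> arc_AC x0 \<and> pt_C x0 \<in> arc_AC x0"
  by (auto simp: pt_A_def pt_C_def arc_AC_def y_C_def powr_powr)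

lemma endpoints_BC: "x0 < 0 \<Longrightarrow> pt_B \<in> arc_BC x0 \<and> pt_C x0 \<in> arc_BC x0"
  by (auto simp: pt_B_def pt_C_def arc_BC_def y_C_def powr_powr)

lemma endpoints_sigma:
  "x0 < 0 \<Longrightarrow> pt_A x0 \<in> arc_sigma x0 \<alpha> \<beta> \<and> pt_B \<in> arc_sigma x0 \<alpha> \<beta>"
  by (auto simp: pt_A_def pt_B_def arc_sigma_def g_def)

text \<open>For \<open>x0 < 0\<close> and \<open>\<alpha> > 0 > \<beta>\<close> the three arcs form a Jordan curve, so exactly one set
  (the inside of the curve) satisfies the description below.\<close>

definition Omega :: "real \<Rightarrow> real \<Rightarrow> real \<Rightarrow> (real \<times> real) set" where
  "Omega x0 \<alpha> \<beta> =
    (THE G. bounded G \<and> open G \<and> connected G \<and> simply_connected G \<and>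
            frontier G = arc_AC x0 \<union> arc_BC x0 \<union> arc_sigma x0 \<alpha> \<beta>)"

text \<open>A vector field is represented by its coefficient map: \<open>D\<close> stands for
  \<open>- 3 x \<partial>\<^sub>x - 2 y \<partial>\<^sub>y\<close>.\<close>

definition D :: "real \<times> real \<Rightarrow> real \<times> real" where
  "D = (\<lambda>(x, y). (- 3 * x, - 2 * y))"

definition flow_D :: "real \<Rightarrow> real \<times> real \<Rightarrow> real \<times> real" where
  "flow_D t = (\<lambda>(x, y). (x * exp (- 3 * t), y * exp (- 2 * t)))"

definition flow_D_infinity :: "real \<times> real \<Rightarrow> real \<times> real" where
  "flow_D_infinity p = Lim at_top (\<lambda>t. flow_D t p)"

text \<open>\<open>flow_D\<close> is indeed the flow generated by \<open>D\<close>: its orbits are exactly the integral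
  curves of \<open>D\<close>.\<close>

lemma flow_D_integral_curve:
  "((\<lambda>t. flow_D t p) has_vector_derivative D (flow_D t p)) (at t)" and flow_D_0: "flow_D 0 p = p"
  by (cases p; auto simp: flow_D_def D_def has_real_derivative_iff_has_vector_derivative[symmetric]
      intro!: has_vector_derivative_Pair derivative_eq_intros)+

lemma flow_D_unique:
  assumes "\<And>t. (\<gamma> has_vector_derivative D (\<gamma> t)) (at t)" and "\<gamma> 0 = p"
  shows "\<gamma> t = flow_D t p"
proof -
  have dx: "((\<lambda>t. fst (\<gamma> t)) has_real_derivative - 3 * fst (\<gamma> t)) (at t)" for t
    using bounded_linear.has_vector_derivative[OF bounded_linear_fst assms(1)[of t]]
    by (simp add: has_real_derivative_iff_has_vector_derivative D_def case_prod_beta)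
  have dy: "((\<lambda>t. snd (\<gamma> t)) has_real_derivative - 2 * snd (\<gamma> t)) (at t)" for t
    using bounded_linear.has_vector_derivative[OF bounded_linear_snd assms(1)[of t]]
    by (simp add: has_real_derivative_iff_has_vector_derivative D_def case_prod_beta)
  have "((\<lambda>t. fst (\<gamma> t) * exp (3 * t)) has_real_derivative 0) (at t)" for t
    by (rule derivative_eq_intros dx refl | simp)+
  from DERIV_isconst_all[of "\<lambda>t. fst (\<gamma> t) * exp (3 * t)" t 0] this
  have x: "fst (\<gamma> t) * exp (3 * t) = fst p" by (simp add: assms(2))
  have "((\<lambda>t. snd (\<gamma> t) * exp (2 * t)) has_real_derivative 0) (at t)" for t
    by (rule derivative_eq_intros dy refl | simp)+
  from DERIV_isconst_all[of "\<lambda>t. snd (\<gamma> t) * exp (2 * t)" t 0] this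
  have y: "snd (\<gamma> t) * exp (2 * t) = snd p" by (simp add: assms(2))
  show ?thesis
    by (simp add: flow_D_def case_prod_beta prod_eq_iff x[symmetric] y[symmetric] exp_minus)
qed

lemma flow_D_infinity_eq: "flow_D_infinity p = (0, 0)"
proof -
  have "((\<lambda>t::real. exp (- (c * t))) \<longlongrightarrow> 0) at_top" if "c > 0" for c :: real
    by (rule filterlim_compose[OF exp_at_bot])
      (simp add: filterlim_uminus_at_bot filterlim_tendsto_pos_mult_at_top[OF tendsto_const that]
        filterlim_ident)
  from this[of 3] this[of 2] have "((\<lambda>t. flow_D t p) \<longlongrightarrow> (0, 0)) at_top"
    by (auto simp: flow_D_def case_prod_beta intro!: tendsto_Pair tendsto_mult_right_zero)
  then show ?thesis
    unfolding flow_D_infinity_def by (intro tendsto_Lim) simp_all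
qed

text \<open>The range \<open>t \<in> [0, +\<infinity>]\<close> is split into real \<open>t \<ge> 0\<close> and \<open>t = +\<infinity>\<close>.\<close>

definition D_star_shaped :: "(real \<times> real) set \<Rightarrow> bool" where
  "D_star_shaped G \<longleftrightarrow> open G \<and>
    (\<forall>p \<in> closure G. (\<forall>t \<ge> 0. flow_D t p \<in> closure G) \<and> flow_D_infinity p \<in> closure G)"

end

theory Submission
  imports Defs
begin

text \<open>The set \<open>\<Omega>\<close> is the region between the graphs over \<open>[2 x\<^sub>0, 0]\<close> of \<open>g\<close> and of
  \<open>x \<mapsto> - (3/2 min (- x) (x - 2 x\<^sub>0)) powr (2/3)\<close>, because the complement of these two graphs has
  only one bounded component. Put \<open>s = exp (- t)\<close>, \<open>u = - x\<close> and \<open>L = - 2 x\<^sub>0\<close>. The lower graph is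
  never crossed since \<open>u \<mapsto> min u (L - u)\<close> is concave. The upper graph is not crossed iff
  \<open>s powr (2 (\<alpha> + 1)) * (L - u) \<le> s ^ 3 * (L - s ^ 3 * u)\<close> for all \<open>s \<in> (0, 1]\<close> and
  \<open>u \<in> (0, L)\<close>, and letting \<open>s \<rightarrow> 0\<close> shows that this means \<open>2 (\<alpha> + 1) \<ge> 3\<close>.\<close>

section \<open>Planar regions between two graphs over an interval\<close>

definition open_between :: "real \<Rightarrow> real \<Rightarrow> (real \<Rightarrow> real) \<Rightarrow> (real \<Rightarrow> real) \<Rightarrow> (real \<times> real) set" where
  "open_between a b h f = {(x, y). a < x \<and> x < b \<and> h x < y \<and> y < f x}"

definition closed_between :: "real \<Rightarrow> real \<Rightarrow> (real \<Rightarrow> real) \<Rightarrow> (real \<Rightarrow> real) \<Rightarrow> (real \<times> real) set" where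
  "closed_between a b h f = {(x, y). a \<le> x \<and> x \<le> b \<and> h x \<le> y \<and> y \<le> f x}"

definition graph_on :: "real \<Rightarrow> real \<Rightarrow> (real \<Rightarrow> real) \<Rightarrow> (real \<times> real) set" where
  "graph_on a b f = {(x, y). a \<le> x \<and> x \<le> b \<and> y = f x}"

text \<open>The boundary functions are known to be continuous only on \<open>{a..b}\<close>. A total
  continuous extension lets regions be described by inequalities between functions continuous on the
  whole plane, and gives sets above and below the graphs that reach past both ends of the
  interval.\<close>

lemma continuous_extension_real:
  fixes f :: "real \<Rightarrow> real"
  assumes "continuous_on {a..b} f"
  obtains f' where "continuous_on UNIV f'" "\<And>x. x \<in> {a..b} \<Longrightarrow> f' x = f x"
proof
  show "continuous_on UNIV (ext_cont f a b)"
    using assms by (intro continuous_on_ext_cont) simp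
qed (simp add: ext_cont_def)

text \<open>A shear along the graph carries an upper half-plane onto this set.\<close>

lemma connected_above_graph:
  fixes f :: "real \<Rightarrow> real"
  assumes "continuous_on UNIV f"
  shows "connected {(x, y). f x < y}"
proof -
  have "{(x, y). f x < y} = (\<lambda>(x, s). (x, f x + s)) ` (UNIV \<times> {0<..})"
  proof (intro set_eqI iffI)
    fix p assume "p \<in> {(x, y). f x < y}"
    then show "p \<in> (\<lambda>(x, s). (x, f x + s)) ` (UNIV \<times> {0<..})"
      by (intro image_eqI[of _ _ "(fst p, snd p - f (fst p))"]) auto
  qed auto
  moreover have "continuous_on (UNIV \<times> {0<..}) (\<lambda>(x, s). (x, f x + s))"
    unfolding case_prod_beta
    by (intro continuous_intros continuous_on_compose2[OF assms]) auto
  ultimately show ?thesis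
    by (simp only: connected_continuous_image connected_Times connected_Ioi connected_UNIV)
qed

lemma connected_below_graph:
  fixes f :: "real \<Rightarrow> real"
  assumes "continuous_on UNIV f"
  shows "connected {(x, y). y < f x}"
proof -
  have "{(x, y). y < f x} = (\<lambda>(x, y). (x, - y)) ` {(x, y). - f x < y}"
    by (auto simp: image_iff intro!: exI[of _ "- _"])
  moreover have "continuous_on {(x, y). - f x < y} (\<lambda>(x, y). (x, - y :: real))"
    unfolding case_prod_beta by (intro continuous_intros)
  moreover have "connected {(x, y). - f x < y}"
    by (intro connected_above_graph continuous_intros assms)
  ultimately show ?thesis
    by (simp only: connected_continuous_image)
qed

lemma
  assumes h: "continuous_on {a..b} h" and f: "continuous_on {a..b} f"
  shows open_open_between: "open (open_between a b h f)"
    and closed_closed_between: "closed (closed_between a b h f)"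
    and bounded_closed_between: "bounded (closed_between a b h f)"
proof -
  obtain h' f' where
    h': "continuous_on UNIV h'" "\<And>x. x \<in> {a..b} \<Longrightarrow> h' x = h x" and
    f': "continuous_on UNIV f'" "\<And>x. x \<in> {a..b} \<Longrightarrow> f' x = f x"
    using continuous_extension_real[OF h] continuous_extension_real[OF f] by metis
  have c: "continuous_on UNIV (\<lambda>p :: real \<times> real. h' (fst p))"
    "continuous_on UNIV (\<lambda>p :: real \<times> real. f' (fst p))"
    by (intro continuous_on_compose2[OF h'(1)] continuous_on_compose2[OF f'(1)]
        continuous_intros; simp)+
  have "open_between a b h f = {p. a < fst p} \<inter> {p. fst p < b}
      \<inter> {p. h' (fst p) < snd p} \<inter> {p. snd p < f' (fst p)}"
    using h' f' by (auto simp: open_between_def)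
  moreover have "open \<dots>"
    by (intro open_Int open_Collect_less continuous_intros c)
  ultimately show "open (open_between a b h f)" by simp
  have "closed_between a b h f = {p. a \<le> fst p} \<inter> {p. fst p \<le> b}
      \<inter> {p. h' (fst p) \<le> snd p} \<inter> {p. snd p \<le> f' (fst p)}"
    using h' f' by (auto simp: closed_between_def)
  moreover have "closed \<dots>"
    by (intro closed_Int closed_Collect_le continuous_intros c)
  ultimately show "closed (closed_between a b h f)" by simp
  have "bounded (h ` {a..b})" "bounded (f ` {a..b})"
    using h f by (auto intro!: compact_imp_bounded compact_continuous_image)
  then obtain M N where M: "\<And>x. x \<in> {a..b} \<Longrightarrow> \<bar>h x\<bar> \<le> M"
    and N: "\<And>x. x \<in> {a..b} \<Longrightarrow> \<bar>f x\<bar> \<le> N"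
    by (fastforce simp: bounded_iff)
  have "closed_between a b h f \<subseteq> {a..b} \<times> {- M..N}"
  proof (clarsimp simp: closed_between_def)
    fix x y assume "a \<le> x" "x \<le> b" "h x \<le> y" "y \<le> f x"
    then show "- M \<le> y \<and> y \<le> N" using M[of x] N[of x] by auto
  qed
  then show "bounded (closed_between a b h f)"
    by (rule bounded_subset[rotated]) (simp add: bounded_Times)
qed

text \<open>After extending both functions, the complement is a union of four connected sets: two
  half-planes, the region above one graph and the region below the other.\<close>

lemma connected_Compl_closed_between:
  assumes h: "continuous_on {a..b} h" and f: "continuous_on {a..b} f"
  shows "connected (- closed_between a b h f)"
proof -
  obtain h' f' where
    h': "continuous_on UNIV h'" "\<And>x. x \<in> {a..b} \<Longrightarrow> h' x = h x" and
    f': "continuous_on UNIV f'" "\<And>x. x \<in> {a..b} \<Longrightarrow> f' x = f x"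
    using continuous_extension_real[OF h] continuous_extension_real[OF f] by metis
  let ?L = "{(x, y). x < a} :: (real \<times> real) set" and ?R = "{(x, y). b < x} :: (real \<times> real) set"
  let ?T = "{(x, y). f' x < y}" and ?B = "{(x, y). y < h' x}"
  have LR: "connected ?L" "connected ?R"
  proof -
    have "?L = {..<a} \<times> UNIV" "?R = {b<..} \<times> UNIV" by auto
    then show "connected ?L" "connected ?R"
      by (simp_all only: connected_Times connected_Iio connected_Ioi connected_UNIV)
  qed
  \<comment> \<open>Points one unit beyond an end of the interval show that each set meets the union
    formed before it.\<close>
  have "(a - 1, f' (a - 1) + 1) \<in> ?L \<inter> ?T" "(a - 1, h' (a - 1) - 1) \<in> ?B \<inter> (?L \<union> ?T)"
    "(b + 1, h' (b + 1) - 1) \<in> ?R \<inter> (?B \<union> (?L \<union> ?T))" by auto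
  then have "connected (?R \<union> (?B \<union> (?L \<union> ?T)))"
    by (intro connected_Un LR connected_above_graph connected_below_graph f' h') blast+
  moreover have "- closed_between a b h f = ?R \<union> (?B \<union> (?L \<union> ?T))"
  proof (rule set_eqI)
    fix p :: "real \<times> real"
    show "p \<in> - closed_between a b h f \<longleftrightarrow> p \<in> ?R \<union> (?B \<union> (?L \<union> ?T))"
      using h'(2)[of "fst p"] f'(2)[of "fst p"]
      by (cases "fst p \<in> {a..b}") (auto simp: closed_between_def)
  qed
  ultimately show ?thesis by simp
qed

section \<open>Two graphs with common endpoints, and the region that they enclose\<close>

locale two_graphs =
  fixes a b :: real and h f :: "real \<Rightarrow> real"
  assumes ab: "a < b"
    and cont_h: "continuous_on {a..b} h" and cont_f: "continuous_on {a..b} f"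
    and less: "\<And>x. a < x \<Longrightarrow> x < b \<Longrightarrow> h x < f x"
    and eq_a: "h a = f a" and eq_b: "h b = f b"
begin

lemma le: "x \<in> {a..b} \<Longrightarrow> h x \<le> f x"
  using less[of x] eq_a eq_b by (cases "x = a"; cases "x = b") (simp_all add: less_imp_le)

text \<open>The map stretches each vertical unit segment linearly onto the segment between the
  graphs. \<open>T\<close> is left free to serve both the open and the closed rectangle.\<close>

lemma continuous_on_fill:
  "continuous_on ({a..b} \<times> T) (\<lambda>(x, s). (x, h x + s * (f x - h x)))"
  unfolding case_prod_beta
  by (intro continuous_intros continuous_on_compose2[OF cont_h] continuous_on_compose2[OF cont_f])
    auto

lemma fill_open:
  "(\<lambda>(x, s). (x, h x + s * (f x - h x))) ` ({a<..<b} \<times> {0<..<1}) = open_between a b h f"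
proof (intro set_eqI iffI)
  fix p assume "p \<in> open_between a b h f"
  then show "p \<in> (\<lambda>(x, s). (x, h x + s * (f x - h x))) ` ({a<..<b} \<times> {0<..<1})"
    by (intro image_eqI[of _ _ "(fst p, (snd p - h (fst p)) / (f (fst p) - h (fst p)))"])
      (auto simp: open_between_def divide_less_eq)
next
  fix p assume "p \<in> (\<lambda>(x, s). (x, h x + s * (f x - h x))) ` ({a<..<b} \<times> {0<..<1})"
  then obtain x s where x: "a < x" "x < b" and s: "0 < s" "s < 1"
    and p: "p = (x, h x + s * (f x - h x))" by auto
  have "0 < s * (f x - h x)" "s * (f x - h x) < 1 * (f x - h x)"
    using less[OF x] s by (simp, intro mult_strict_right_mono) auto
  then show "p \<in> open_between a b h f"
    using x p by (simp add: open_between_def)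
qed

text \<open>The stretching map is a homeomorphism from an open rectangle, which is convex. Over the
  open interval \<open>less\<close> keeps the divisor \<open>f x - h x\<close> of the inverse
  positive.\<close>

lemma simply_connected_open_between: "simply_connected (open_between a b h f)"
proof -
  let ?\<phi> = "\<lambda>(x, s). (x, h x + s * (f x - h x))"
  let ?\<psi> = "\<lambda>(x, y). (x, (y - h x) / (f x - h x))"
  have "homeomorphism ({a<..<b} \<times> {0<..<1}) (open_between a b h f) ?\<phi> ?\<psi>"
  proof (rule homeomorphismI)
    show "continuous_on ({a<..<b} \<times> {0<..<1}) ?\<phi>"
      by (rule continuous_on_subset[OF continuous_on_fill[of "{0<..<1}"]]) auto
    show "continuous_on (open_between a b h f) ?\<psi>"
      unfolding case_prod_beta
      by (intro continuous_intros continuous_on_compose2[OF cont_h]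
          continuous_on_compose2[OF cont_f]) (auto simp: open_between_def)
    show "?\<phi> ` ({a<..<b} \<times> {0<..<1}) \<subseteq> open_between a b h f"
      using fill_open by simp
    show "?\<psi> ` open_between a b h f \<subseteq> {a<..<b} \<times> {0<..<1}"
      by (auto simp: open_between_def field_simps)
    show "?\<psi> (?\<phi> p) = p" if "p \<in> {a<..<b} \<times> {0<..<1}" for p
      using that less[of "fst p"] by auto
    show "?\<phi> (?\<psi> p) = p" if "p \<in> open_between a b h f" for p
      using that by (auto simp: open_between_def)
  qed
  moreover have "simply_connected ({a<..<b} \<times> {0<..<1::real})"
    by (intro convex_imp_simply_connected convex_Times) simp_all
  ultimately show ?thesis
    using homeomorphic_simply_connected_eq homeomorphic_def by blast
qed

text \<open>By continuity, the image of the closed rectangle lies in the closure of the image of the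
  open one. Injectivity, which fails over the endpoints, does not enter.\<close>

lemma closure_open_between: "closure (open_between a b h f) = closed_between a b h f"
proof
  show "closure (open_between a b h f) \<subseteq> closed_between a b h f"
    by (rule closure_minimal[OF _ closed_closed_between[OF cont_h cont_f]])
      (auto simp: open_between_def closed_between_def)
  let ?\<phi> = "\<lambda>(x, s). (x, h x + s * (f x - h x))"
  have cl: "closure ({a<..<b} \<times> {0<..<1::real}) = {a..b} \<times> {0..1}"
    using ab by (simp add: closure_Times)
  have "p \<in> ?\<phi> ` ({a..b} \<times> {0..1})" if p: "p \<in> closed_between a b h f" for p
  proof -
    obtain x y where xy: "p = (x, y)" "x \<in> {a..b}" "h x \<le> y" "y \<le> f x"
      using p by (auto simp: closed_between_def)
    \<comment> \<open>Where the graphs meet, the segment is a single point and any height in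
      \<open>{0..1}\<close> would do.\<close>
    define s where "s = (if f x = h x then 0 else (y - h x) / (f x - h x))"
    have "s \<in> {0..1}" "y = h x + s * (f x - h x)"
      using xy(3,4) by (auto simp: s_def field_simps)
    then show ?thesis using xy by (intro image_eqI[of _ _ "(x, s)"]) auto
  qed
  moreover have "?\<phi> ` ({a..b} \<times> {0..1}) \<subseteq> closure (?\<phi> ` ({a<..<b} \<times> {0<..<1}))"
    unfolding cl[symmetric]
    by (rule image_closure_subset) (simp_all only: cl continuous_on_fill closed_closure closure_subset)
  ultimately show "closed_between a b h f \<subseteq> closure (open_between a b h f)"
    unfolding fill_open by blast
qed

text \<open>By \<open>eq_a\<close> and \<open>eq_b\<close> the vertical sides shrink to points, so
  the two graphs make up the whole boundary.\<close>

lemma closed_between_eq_Un: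
  "closed_between a b h f = open_between a b h f \<union> graph_on a b h \<union> graph_on a b f"
proof -
  have "p \<in> closed_between a b h f \<longleftrightarrow>
      p \<in> open_between a b h f \<union> graph_on a b h \<union> graph_on a b f" for p
    using le[of "fst p"] eq_a eq_b
    by (cases p; cases "fst p = a"; cases "fst p = b")
      (auto simp: closed_between_def open_between_def graph_on_def)
  then show ?thesis by blast
qed

lemma frontier_open_between:
  "frontier (open_between a b h f) = graph_on a b h \<union> graph_on a b f"
proof -
  have "open_between a b h f \<inter> (graph_on a b h \<union> graph_on a b f) = {}"
    by (auto simp: open_between_def graph_on_def)
  then show ?thesis
    unfolding frontier_def closure_open_between
      interior_open[OF open_open_between[OF cont_h cont_f]] closed_between_eq_Un by blast
qed

text \<open>A connected set that misses \<open>frontier G\<close> is contained in \<open>G\<close>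
  or disjoint from it. The region and its exterior are two such sets; the exterior is unbounded, so
  \<open>G\<close> must be the region.\<close>

lemma open_between_unique:
  assumes "bounded G" "open G" "connected G"
    and fr: "frontier G = graph_on a b h \<union> graph_on a b f"
  shows "G = open_between a b h f"
proof -
  let ?R = "open_between a b h f" and ?E = "- closed_between a b h f"
  have "(a, h a) \<in> frontier G"
    using ab by (simp add: fr graph_on_def)
  then have ne: "G \<noteq> {}" by auto
  have disj: "G \<inter> frontier G = {}"
    using \<open>open G\<close> by (simp add: frontier_def interior_open)
  have all: "S \<subseteq> G" if "connected S" "S \<inter> G \<noteq> {}" "S \<inter> frontier G = {}" for S
    using connected_Int_frontier[of S G] that by blast
  have R: "connected ?R" "?R \<inter> frontier G = {}"
    using simply_connected_open_between simply_connected_imp_connected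
      frontier_open_between fr open_open_between[OF cont_h cont_f]
    by (auto simp: frontier_def interior_open)
  have E: "connected ?E" "?E \<inter> frontier G = {}"
    using connected_Compl_closed_between[OF cont_h cont_f] closed_between_eq_Un fr by auto
  have "G \<inter> ?E = {}"
  proof (rule ccontr)
    assume "G \<inter> ?E \<noteq> {}"
    then have "?E \<subseteq> G" using all E by blast
    then have "bounded ?E" by (rule bounded_subset[OF \<open>bounded G\<close>])
    then have "bounded (?E \<union> closed_between a b h f)"
      using bounded_closed_between[OF cont_h cont_f] by (simp only: bounded_Un)
    then show False by (simp only: Compl_partition2 not_bounded_UNIV)
  qed
  then have "G \<subseteq> ?R" using closed_between_eq_Un disj fr by blast
  moreover then have "?R \<subseteq> G" using all[of ?R] R ne by blast
  ultimately show ?thesis by blast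
qed

lemma The_open_between:
  "(THE G. bounded G \<and> open G \<and> connected G \<and> simply_connected G \<and>
      frontier G = graph_on a b h \<union> graph_on a b f) = open_between a b h f"
proof (rule the_equality)
  have "bounded (open_between a b h f)"
    using bounded_closed_between[OF cont_h cont_f] closed_between_eq_Un
    by (auto intro: bounded_subset)
  then show "bounded (open_between a b h f) \<and> open (open_between a b h f) \<and>
      connected (open_between a b h f) \<and> simply_connected (open_between a b h f) \<and>
      frontier (open_between a b h f) = graph_on a b h \<union> graph_on a b f"
    using simply_connected_open_between open_open_between[OF cont_h cont_f]
      simply_connected_imp_connected frontier_open_between by blast
next
  fix G assume "bounded G \<and> open G \<and> connected G \<and> simply_connected G \<and>
      frontier G = graph_on a b h \<union> graph_on a b f"
  then show "G = open_between a b h f" by (elim conjE) (rule open_between_unique)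
qed

end

section \<open>The arcs of the boundary as graphs\<close>

definition lower :: "real \<Rightarrow> real \<Rightarrow> real" where
  "lower x0 x = - ((3 / 2 * min (- x) (x - 2 * x0)) powr (2 / 3))"

lemma powr_le_powr_iff:
  fixes p x y :: real
  assumes "0 < p" "0 \<le> x" "0 \<le> y"
  shows "x powr p \<le> y powr p \<longleftrightarrow> x \<le> y"
  using assms powr_mono2[of p x y] powr_less_mono2[of p y x] by fastforce

lemma powr_two_thirds_iff:
  fixes m z :: real
  assumes "0 \<le> m" "0 \<le> z"
  shows "3 * m = 2 * z powr (3 / 2) \<longleftrightarrow> z = (3 / 2 * m) powr (2 / 3)"
proof
  assume "3 * m = 2 * z powr (3 / 2)"
  then have "3 / 2 * m = z powr (3 / 2)" by simp
  then show "z = (3 / 2 * m) powr (2 / 3)" using assms by (simp add: powr_powr)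
next
  assume "z = (3 / 2 * m) powr (2 / 3)"
  then show "3 * m = 2 * z powr (3 / 2)" using assms by (simp add: powr_powr)
qed

text \<open>\<open>lower\<close> solves both arc equations for y. The minimum in it is
  \<open>- x\<close> on BC, where \<open>x \<ge> x0\<close>, and \<open>x - 2 * x0\<close> on AC,
  where \<open>x \<le> x0\<close>.\<close>

lemma arcs_eq_graph_lower:
  assumes "x0 < 0"
  shows "arc_AC x0 \<union> arc_BC x0 = graph_on (2 * x0) 0 (lower x0)"
proof -
  have yC: "y_C x0 \<le> y \<longleftrightarrow> (- y) powr (3 / 2) \<le> 3 / 2 * (- x0)" if "y \<le> 0" for y
  proof -
    have "(- y) powr (3 / 2) \<le> 3 / 2 * (- x0) \<longleftrightarrow>
        ((- y) powr (3 / 2)) powr (2 / 3) \<le> (3 / 2 * (- x0)) powr (2 / 3)"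
      using assms by (subst powr_le_powr_iff) auto
    also have "\<dots> \<longleftrightarrow> y_C x0 \<le> y"
      using assms that by (auto simp: powr_powr y_C_def)
    finally show ?thesis by simp
  qed
  \<comment> \<open>The numbers \<open>- x\<close> and \<open>x - 2 * x0\<close> add up to
    \<open>- 2 * x0\<close>, so one of them that is at most \<open>- x0\<close> is their
    minimum.\<close>
  have sides: "q \<le> 3 / 2 * (- x0) \<and> (3 * (x - 2 * x0) = 2 * q \<or> 3 * (- x) = 2 * q) \<longleftrightarrow>
      0 \<le> min (- x) (x - 2 * x0) \<and> 3 * min (- x) (x - 2 * x0) = 2 * q" if "0 \<le> q" for q x
    using that assms by (auto simp: min_def)
  have "(x, y) \<in> arc_AC x0 \<union> arc_BC x0 \<longleftrightarrow> (x, y) \<in> graph_on (2 * x0) 0 (lower x0)" for x y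
  proof (cases "y \<le> 0")
    case False
    then show ?thesis
      using powr_ge_zero[of "3 / 2 * min (- x) (x - 2 * x0)" "2 / 3"]
      by (auto simp: arc_AC_def arc_BC_def graph_on_def lower_def)
  next
    case True
    let ?p = "(- y) powr (3 / 2)" and ?m = "min (- x) (x - 2 * x0)"
    have "(x, y) \<in> arc_AC x0 \<union> arc_BC x0 \<longleftrightarrow>
        ?p \<le> 3 / 2 * (- x0) \<and> (3 * (x - 2 * x0) = 2 * ?p \<or> 3 * (- x) = 2 * ?p)"
      using True yC[OF True] by (auto simp: arc_AC_def arc_BC_def)
    also have "\<dots> \<longleftrightarrow> 0 \<le> ?m \<and> 3 * ?m = 2 * ?p"
      by (rule sides) simp
    also have "\<dots> \<longleftrightarrow> 0 \<le> ?m \<and> - y = (3 / 2 * ?m) powr (2 / 3)"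
      using True by (intro conj_cong refl powr_two_thirds_iff) auto
    also have "\<dots> \<longleftrightarrow> (x, y) \<in> graph_on (2 * x0) 0 (lower x0)"
      by (auto simp: graph_on_def lower_def)
    finally show ?thesis .
  qed
  then show ?thesis by auto
qed

lemma arc_sigma_eq_graph: "arc_sigma x0 \<alpha> \<beta> = graph_on (2 * x0) 0 (g x0 \<alpha> \<beta>)"
  by (auto simp: arc_sigma_def graph_on_def)

lemma two_graphs_lower_g:
  assumes "x0 < 0" "\<alpha> > 0" "0 > \<beta>"
  shows "two_graphs (2 * x0) 0 (lower x0) (g x0 \<alpha> \<beta>)"
proof
  show "2 * x0 < 0" using assms by simp
  show "continuous_on {2 * x0..0} (lower x0)"
    unfolding lower_def by (intro continuous_intros continuous_on_powr') auto
  show "continuous_on {2 * x0..0} (g x0 \<alpha> \<beta>)"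
  proof -
    \<comment> \<open>The base vanishes at both endpoints. Continuity of \<open>powr\<close> there
      rests on a nonnegative base and a positive exponent.\<close>
    have "0 \<le> (\<alpha> + 1) * \<bar>\<beta>\<bar> * x * (2 * x0 - x) / 2" if "x \<in> {2 * x0..0}" for x
    proof -
      have "0 \<le> x * (2 * x0 - x)" using that by (intro mult_nonpos_nonpos) auto
      moreover have "0 \<le> (\<alpha> + 1) * \<bar>\<beta>\<bar>"
        using assms by (intro mult_nonneg_nonneg) auto
      ultimately have "0 \<le> (\<alpha> + 1) * \<bar>\<beta>\<bar> * (x * (2 * x0 - x))"
        by (rule mult_nonneg_nonneg[rotated])
      then show ?thesis by (simp add: mult.assoc)
    qed
    moreover have "0 < 1 / (\<alpha> + 1)" using assms by simp
    moreover have "continuous_on {2 * x0..0} (\<lambda>x. (\<alpha> + 1) * \<bar>\<beta>\<bar> * x * (2 * x0 - x) / 2)"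
      by (intro continuous_intros) simp
    ultimately show ?thesis
      unfolding g_def by (intro continuous_on_powr' continuous_on_const) blast+
  qed
  show "lower x0 x < g x0 \<alpha> \<beta> x" if "2 * x0 < x" "x < 0" for x
  proof -
    have "lower x0 x < 0" using that by (auto simp: lower_def)
    also have "0 \<le> g x0 \<alpha> \<beta> x" by (simp add: g_def)
    finally show ?thesis .
  qed
  show "lower x0 (2 * x0) = g x0 \<alpha> \<beta> (2 * x0)" "lower x0 0 = g x0 \<alpha> \<beta> 0"
    using assms by (simp_all add: lower_def g_def min_def)
qed

lemma Omega_eq:
  assumes "x0 < 0" "\<alpha> > 0" "0 > \<beta>"
  shows "Omega x0 \<alpha> \<beta> = open_between (2 * x0) 0 (lower x0) (g x0 \<alpha> \<beta>)"
  unfolding Omega_def arcs_eq_graph_lower[OF assms(1)] arc_sigma_eq_graph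
  by (rule two_graphs.The_open_between[OF two_graphs_lower_g[OF assms]])

section \<open>The flow against the lower and the upper graph\<close>

lemma le_mult_power:
  fixes x s :: real
  assumes "x \<le> 0" "0 < s" "s \<le> 1"
  shows "x \<le> x * s ^ n"
  using mult_left_mono_neg[of "s ^ n" 1 x] assms by (simp add: power_le_one)

text \<open>The minimum is concave and vanishes at 0, so scaling x by \<open>s ^ 3\<close> leaves at
  least the fraction \<open>s ^ 3\<close> of it. The power 2/3 turns this into \<open>s ^ 2\<close>,
  the factor by which the flow scales y.\<close>

lemma lower_flow:
  assumes "2 * x0 \<le> x" "x \<le> 0" and s: "0 < s" "s \<le> 1"
  shows "lower x0 (x * s ^ 3) \<le> lower x0 x * s ^ 2"
proof -
  let ?m = "\<lambda>x. min (- x) (x - 2 * x0)"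
  have s3: "0 < s ^ 3" "s ^ 3 \<le> 1" using s by (simp_all add: power_le_one)
  \<comment> \<open>Only the branch \<open>x - 2 * x0\<close> is not homogeneous; this handles its
    constant term.\<close>
  have "(- 2 * x0) * s ^ 3 \<le> (- 2 * x0) * 1"
    using assms s3 by (intro mult_left_mono) auto
  then have "s ^ 3 * ?m x \<le> ?m (x * s ^ 3)"
    using s3 by (auto simp: min_mult_distrib_left algebra_simps)
  then have "(s ^ 3 * (3 / 2 * ?m x)) powr (2 / 3) \<le> (3 / 2 * ?m (x * s ^ 3)) powr (2 / 3)"
    using assms s3 by (intro powr_mono2) auto
  moreover have "(s ^ 3 * (3 / 2 * ?m x)) powr (2 / 3) = s ^ 2 * (3 / 2 * ?m x) powr (2 / 3)"
    using assms s by (subst powr_mult) (auto simp: powr_powr simp flip: powr_numeral)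
  ultimately show ?thesis by (simp add: lower_def mult.commute)
qed

text \<open>Raising both sides to the power \<open>\<alpha> + 1\<close> exposes the bases and turns
  \<open>s ^ 2\<close> into \<open>s powr (2 * (\<alpha> + 1))\<close>; a common positive factor
  then cancels.\<close>

lemma g_flow_iff:
  assumes "\<alpha> > 0" "0 > \<beta>" "2 * x0 < x" "x < 0" and s: "0 < s" "s \<le> 1"
  shows "g x0 \<alpha> \<beta> x * s ^ 2 \<le> g x0 \<alpha> \<beta> (x * s ^ 3) \<longleftrightarrow>
    s powr (2 * (\<alpha> + 1)) * (x - 2 * x0) \<le> s ^ 3 * (x * s ^ 3 - 2 * x0)"
proof -
  \<comment> \<open>The base of \<open>g\<close> is \<open>c * (x - 2 * x0)\<close> at
    \<open>x\<close> and \<open>c * s ^ 3 * (x * s ^ 3 - 2 * x0)\<close> at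
    \<open>x * s ^ 3\<close>.\<close>
  define c where "c = (\<alpha> + 1) * \<bar>\<beta>\<bar> * (- x) / 2"
  have c: "c > 0" using assms by (simp add: c_def mult_pos_neg mult_neg_neg)
  have pos: "0 \<le> x * s ^ 3 - 2 * x0"
    using le_mult_power[of x s 3] assms by linarith
  have "2 * (\<alpha> + 1) * (1 / (\<alpha> + 1)) = 2"
    using assms by (simp add: nonzero_divide_eq_eq)
  then have "(s powr (2 * (\<alpha> + 1))) powr (1 / (\<alpha> + 1)) = s powr 2"
    by (simp only: powr_powr)
  then have "g x0 \<alpha> \<beta> x * s ^ 2 =
      (c * (x - 2 * x0)) powr (1 / (\<alpha> + 1)) * (s powr (2 * (\<alpha> + 1))) powr (1 / (\<alpha> + 1))"
    using s by (simp add: g_def c_def algebra_simps)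
  also have "\<dots> = (c * (s powr (2 * (\<alpha> + 1)) * (x - 2 * x0))) powr (1 / (\<alpha> + 1))"
    using assms c by (subst powr_mult[symmetric]) (auto simp: mult_ac)
  finally have 1: "g x0 \<alpha> \<beta> x * s ^ 2 = \<dots>" .
  have 2: "g x0 \<alpha> \<beta> (x * s ^ 3) = (c * (s ^ 3 * (x * s ^ 3 - 2 * x0))) powr (1 / (\<alpha> + 1))"
    by (simp add: g_def c_def field_simps)
  show ?thesis
    unfolding 1 2 using assms c pos by (subst powr_le_powr_iff) auto
qed

text \<open>The flow keeps the order of points on a vertical line, so only the two graphs have to be
  followed. \<open>lower_flow\<close> settles the lower one and \<open>g_flow_iff\<close> translates
  the upper one.\<close>

lemma D_star_shaped_Omega_iff:
  assumes "x0 < 0" "\<alpha> > 0" "0 > \<beta>"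
  shows "D_star_shaped (Omega x0 \<alpha> \<beta>) \<longleftrightarrow>
    (\<forall>x s. 2 * x0 < x \<longrightarrow> x < 0 \<longrightarrow> 0 < s \<longrightarrow> s \<le> 1 \<longrightarrow>
      s powr (2 * (\<alpha> + 1)) * (x - 2 * x0) \<le> s ^ 3 * (x * s ^ 3 - 2 * x0))"
    (is "?lhs \<longleftrightarrow> ?rhs")
proof -
  interpret two_graphs "2 * x0" 0 "lower x0" "g x0 \<alpha> \<beta>"
    by (rule two_graphs_lower_g[OF assms])
  let ?K = "closed_between (2 * x0) 0 (lower x0) (g x0 \<alpha> \<beta>)"
  have flow: "flow_D t (x, y) = (x * exp (- t) ^ 3, y * exp (- t) ^ 2)" for t x y
    by (simp add: flow_D_def flip: exp_of_nat_mult)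
  have clos: "closure (Omega x0 \<alpha> \<beta>) = ?K"
    unfolding Omega_eq[OF assms] by (rule closure_open_between)
  show ?thesis
  proof
    assume L: ?lhs
    show ?rhs
    proof (intro allI impI)
      fix x s :: real assume x: "2 * x0 < x" "x < 0" and s: "0 < s" "s \<le> 1"
      \<comment> \<open>The test points lie on the upper graph, and time \<open>- ln s\<close>
        yields the factor \<open>s\<close>.\<close>
      have "(x, g x0 \<alpha> \<beta> x) \<in> ?K"
        using x less[of x] by (simp add: closed_between_def)
      moreover have "0 \<le> - ln s" using s by simp
      ultimately have "flow_D (- ln s) (x, g x0 \<alpha> \<beta> x) \<in> ?K"
        using L unfolding D_star_shaped_def clos by blast
      then have "g x0 \<alpha> \<beta> x * s ^ 2 \<le> g x0 \<alpha> \<beta> (x * s ^ 3)"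
        unfolding flow using s by (simp add: closed_between_def)
      then show "s powr (2 * (\<alpha> + 1)) * (x - 2 * x0) \<le> s ^ 3 * (x * s ^ 3 - 2 * x0)"
        using g_flow_iff[OF assms(2,3) x s] by simp
    qed
  next
    assume R: ?rhs
    have "flow_D t (x, y) \<in> ?K" if xy: "(x, y) \<in> ?K" and "0 \<le> t" for t x y
    proof -
      define s where "s = exp (- t)"
      have s: "0 < s" "s \<le> 1" using \<open>0 \<le> t\<close> by (simp_all add: s_def)
      have x: "2 * x0 \<le> x" "x \<le> 0" and y: "lower x0 x \<le> y" "y \<le> g x0 \<alpha> \<beta> x"
        using xy by (auto simp: closed_between_def)
      have 1: "2 * x0 \<le> x * s ^ 3" "x * s ^ 3 \<le> 0"
        using le_mult_power[of x s 3] x s by (linarith, simp add: mult_nonpos_nonneg)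
      have 2: "lower x0 (x * s ^ 3) \<le> y * s ^ 2"
        using lower_flow[OF x s] mult_right_mono[OF y(1), of "s ^ 2"] by simp
      have "g x0 \<alpha> \<beta> x * s ^ 2 \<le> g x0 \<alpha> \<beta> (x * s ^ 3)"
      proof (cases "2 * x0 < x \<and> x < 0")
        case True
        then show ?thesis using R g_flow_iff[OF assms(2,3) _ _ s] s by blast
      next
        \<comment> \<open>At the endpoints, which the inequality leaves out, \<open>g\<close> is 0,
          while its values are never negative.\<close>
        case False
        then have "g x0 \<alpha> \<beta> x = 0" using x by (auto simp: g_def)
        then show ?thesis by (simp only: mult_zero_left) (simp add: g_def)
      qed
      then have 3: "y * s ^ 2 \<le> g x0 \<alpha> \<beta> (x * s ^ 3)"
        using mult_right_mono[OF y(2), of "s ^ 2"] by simp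
      show ?thesis
        using 1 2 3 by (simp add: flow closed_between_def flip: s_def)
    qed
    \<comment> \<open>This point is the value of the flow at infinite time.\<close>
    moreover have "(0, 0) \<in> ?K"
      using assms by (simp add: closed_between_def lower_def g_def)
    moreover have "open (Omega x0 \<alpha> \<beta>)"
      unfolding Omega_eq[OF assms] by (rule open_open_between[OF cont_h cont_f])
    ultimately show ?lhs
      unfolding D_star_shaped_def clos flow_D_infinity_eq by auto
  qed
qed

theorem lemma4p3:
  fixes x0 \<alpha> \<beta> :: real
  assumes "x0 < 0" and "\<alpha> > 0" and "0 > \<beta>"
  shows "D_star_shaped (Omega x0 \<alpha> \<beta>) \<longleftrightarrow> \<alpha> \<ge> 1 / 2"
  unfolding D_star_shaped_Omega_iff[OF assms]
proof
  assume R: "\<alpha> \<ge> 1 / 2"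
  show "\<forall>x s. 2 * x0 < x \<longrightarrow> x < 0 \<longrightarrow> 0 < s \<longrightarrow> s \<le> 1 \<longrightarrow>
      s powr (2 * (\<alpha> + 1)) * (x - 2 * x0) \<le> s ^ 3 * (x * s ^ 3 - 2 * x0)"
  proof (intro allI impI)
    fix x s :: real assume x: "2 * x0 < x" "x < 0" and s: "0 < s" "s \<le> 1"
    \<comment> \<open>For \<open>s \<le> 1\<close> a larger exponent gives a smaller power, and here
      \<open>2 * (\<alpha> + 1) \<ge> 3\<close>.\<close>
    have "s powr (2 * (\<alpha> + 1)) \<le> s powr 3"
      using R s by (intro powr_mono') auto
    moreover have "x \<le> x * s ^ 3" using x s by (intro le_mult_power) auto
    ultimately show "s powr (2 * (\<alpha> + 1)) * (x - 2 * x0) \<le> s ^ 3 * (x * s ^ 3 - 2 * x0)"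
      using x s by (intro mult_mono) auto
  qed
next
  assume L: "\<forall>x s. 2 * x0 < x \<longrightarrow> x < 0 \<longrightarrow> 0 < s \<longrightarrow> s \<le> 1 \<longrightarrow>
      s powr (2 * (\<alpha> + 1)) * (x - 2 * x0) \<le> s ^ 3 * (x * s ^ 3 - 2 * x0)"
  show "\<alpha> \<ge> 1 / 2"
  proof (rule ccontr)
    assume "\<not> \<alpha> \<ge> 1 / 2"
    then have p: "1 - 2 * \<alpha> > 0" by simp
    \<comment> \<open>One explicit \<open>s\<close> replaces the limit. It satisfies
      \<open>s powr (1 - 2 * \<alpha>) = 1 / 4\<close>, and the exponents
      \<open>1 - 2 * \<alpha>\<close> and \<open>2 * (\<alpha> + 1)\<close> add up to 3, so the left
      factor becomes \<open>4 * s ^ 3\<close>.\<close>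
    define s :: real where "s = (1 / 4) powr (1 / (1 - 2 * \<alpha>))"
    have s: "0 < s" "s \<le> 1"
      using p powr_mono2[of "1 / (1 - 2 * \<alpha>)" "1 / 4" 1] by (auto simp: s_def)
    have "s powr (1 - 2 * \<alpha>) = 1 / 4" using p by (simp add: s_def powr_powr)
    moreover have "s powr (1 - 2 * \<alpha>) * s powr (2 * (\<alpha> + 1)) = s powr 3"
      by (simp flip: powr_add)
    ultimately have eq: "s powr (2 * (\<alpha> + 1)) = 4 * s ^ 3"
      using s by (simp only:) simp
    \<comment> \<open>At the midpoint \<open>x0\<close>, dividing by \<open>s ^ 3\<close> bounds
      \<open>- 4 * x0\<close> by \<open>x0 * s ^ 3 - 2 * x0\<close>, which is less than
      \<open>- 2 * x0\<close>.\<close>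
    have "s powr (2 * (\<alpha> + 1)) * (x0 - 2 * x0) \<le> s ^ 3 * (x0 * s ^ 3 - 2 * x0)"
      using L[rule_format, of x0 s] assms s by simp
    then have "s ^ 3 * (4 * (- x0)) \<le> s ^ 3 * (x0 * s ^ 3 - 2 * x0)"
      unfolding eq by (simp add: algebra_simps)
    then have "4 * (- x0) \<le> x0 * s ^ 3 - 2 * x0"
      by (rule mult_left_le_imp_le) (use s in simp)
    moreover have "x0 * s ^ 3 < 0" using assms s by (simp add: mult_neg_pos)
    ultimately show False using assms by simp
  qed
qed

end
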